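(* Let $\Gamma\in\mathbb{N}$. For any $\alpha=\Gamma+1-\frac{1}{\beta}$ with $\beta\in\mathbb{N}$ there are instances (graphs $G=(V,A,s,t,u)$) such that $f^*_{am}=\alpha f^*_{pm}$ and $f^*_{gm}=\alpha f^*_{pm}$, where $f^*_{pm}$, $f^*_{am}$, $f^*_{gm}$ are the optimal values of the path model (PM), the arc model (AM) and the general model (GM), respectively.
   Context: $\mathbb{N}=\{1,2,\dots\}$. $G=(V,A,s,t,u)$ is a finite directed graph (parallel arcs allowed) with two distinct nodes, source $s$ and sink $t$, and capacities $u_a\in\mathbb{N}$ for $a\in A$. The source $s$ has no incoming arcs, $t$ has no outgoing arcs, and for every $v\in V\setminus\{s,t\}$ there is a directed $s$-$v$-$t$-path. $\delta_A^-(v)$, $\delta_A^+(v)$ are the sets of incoming and outgoing arcs of $v$. For $\Gamma\in\mathbb{N}$ let $\mathcal{S}=\{S\subseteq A: |S|\le\Gamma\}$ and $\Lambda=\{z\in\{0,1\}^{|A|}:\sum_{a\in A}z(a)\le\Gamma\}$. $\mathcal{P}$ is the set of all simple $s$-$t$-paths, and $\bar{\mathcal{P}}$ is the set of all directed $v$-$w$-paths $P$ ($v,w\in V$, at least one arc) that are subpaths of some path in $\mathcal{P}$; paths are identified with their arc sets. $\delta_{\bar{\mathcal{P}}}^-(v)$ and $\delta_{\bar{\mathcal{P}}}^+(v)$ are the sets of paths in $\bar{\mathcal{P}}$ ending at $v$ and starting at $v$. Path model (PM): $f^*_{pm}=\max_{x\in\mathbb{R}_{\ge0}^{|\mathcal{P}|}}\sum_{P\in\mathcal{P}}x(P)-\max_{S\in\mathcal{S}}\sum_{P\in\mathcal{P}:P\cap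 S\ne\emptyset}x(P)$ subject to $\sum_{P\in\mathcal{P}:a\in P}x(P)\le u_a$ for all $a\in A$. Arc model (AM): $f^*_{am}=\max_{x\in\mathbb{R}_{\ge0}^{|A|}}\sum_{a\in\delta_A^-(t)}x(a)-\max_{z\in\Lambda}\sum_{a\in\delta_A^-(t)}z(a)x(a)$ subject to $\sum_{a\in\delta_A^-(v)}(1-z(a))x(a)-\sum_{a\in\delta_A^+(v)}x(a)\ge0$ for all $v\in V\setminus\{s,t\}$, $z\in\Lambda$, and $x(a)\le u_a$ for all $a\in A$. General model (GM): $f^*_{gm}=\max_{x\in\mathbb{R}^{|\bar{\mathcal{P}}|}_{\ge0}}\sum_{P\in\delta_{\bar{\mathcal{P}}}^-(t)}x(P)-\max_{S\in\mathcal{S}}\sum_{P\in\delta_{\bar{\mathcal{P}}}^-(t):P\cap S\ne\emptyset}x(P)$ subject to $\sum_{P\in\delta_{\bar{\mathcal{P}}}^-(v)}x(P)-\sum_{P\in\delta_{\bar{\mathcal{P}}}^-(v):P\cap S\neq\emptyset}x(P)\ge\sum_{P\in\delta_{\bar{\mathcal{P}}}^+(v)}x(P)$ for all $v\in V\setminus\{s,t\}$, $S\in\mathcal{S}$, and $\sum_{P\in\bar{\mathcal{P}}:a\in P}x(P)\le u_a$ for all $a\in A$. *)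

theory Defs
  imports Complex_Main "HOL-Library.FuncSet" "HOL-Library.Sublist" "Graph_Theory.Digraph"
    "Graph_Theory.Arc_Walk"
begin

text \<open>
  The ``directed s-v-t-path'' required for every inner node is read as a simple path.
\<close>
locale flow_network = fin_digraph G for G :: "('a, 'b) pre_digraph" +
  fixes s t :: 'a and u :: "'b \<Rightarrow> nat"
  assumes source_in_verts: "s \<in> verts G"
    and sink_in_verts: "t \<in> verts G"
    and source_neq_sink: "s \<noteq> t"
    and capacity_pos: "a \<in> arcs G \<Longrightarrow> u a \<ge> 1"
    and no_arc_into_source: "in_arcs G s = {}"
    and no_arc_out_of_sink: "out_arcs G t = {}"
    and on_st_path: "v \<in> verts G - {s, t} \<Longrightarrow> \<exists>p. apath s p t \<and> v \<in> set (awalk_verts s p)"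
begin

definition scenarios :: "nat \<Rightarrow> 'b set set" where
  "scenarios \<Gamma> = {S. S \<subseteq> arcs G \<and> card S \<le> \<Gamma>}"

definition scenario_vectors :: "nat \<Rightarrow> ('b \<Rightarrow> real) set" where
  "scenario_vectors \<Gamma> = {z \<in> arcs G \<rightarrow>\<^sub>E {0, 1}. (\<Sum>a\<in>arcs G. z a) \<le> real \<Gamma>}"

definition st_paths :: "'b set set" where
  "st_paths = {set p | p. apath s p t}"

text \<open>Contiguous pieces, with at least one arc, of simple source-sink paths.\<close>
definition is_subpath :: "'a \<Rightarrow> 'b list \<Rightarrow> 'a \<Rightarrow> bool" where
  "is_subpath v q w \<longleftrightarrow> apath v q w \<and> q \<noteq> [] \<and> (\<exists>p. apath s p t \<and> sublist q p)"

definition subpaths :: "'b set set" where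
  "subpaths = {set q | v q w. is_subpath v q w}"

definition subpaths_in :: "'a \<Rightarrow> 'b set set" where
  "subpaths_in w = {set q | v q. is_subpath v q w}"

definition subpaths_out :: "'a \<Rightarrow> 'b set set" where
  "subpaths_out v = {set q | q w. is_subpath v q w}"

text \<open>
  In all three models a vector indexed by paths or arcs is a total function; its values outside
  the index set occur neither in the constraints nor in the objective.
\<close>

subsection \<open>Path model\<close>

definition pm_feasible :: "('b set \<Rightarrow> real) \<Rightarrow> bool" where
  "pm_feasible x \<longleftrightarrow>
     (\<forall>P\<in>st_paths. 0 \<le> x P) \<and>
     (\<forall>a\<in>arcs G. (\<Sum>P\<in>{P \<in> st_paths. a \<in> P}. x P) \<le> real (u a))"

definition pm_objective :: "nat \<Rightarrow> ('b set \<Rightarrow> real) \<Rightarrow> real" where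
  "pm_objective \<Gamma> x =
     (\<Sum>P\<in>st_paths. x P)
     - (MAX S\<in>scenarios \<Gamma>. \<Sum>P\<in>{P \<in> st_paths. P \<inter> S \<noteq> {}}. x P)"

definition pm_optimal_value :: "nat \<Rightarrow> real \<Rightarrow> bool" where
  "pm_optimal_value \<Gamma> f \<longleftrightarrow>
     (\<exists>x. is_arg_max (pm_objective \<Gamma>) pm_feasible x \<and> f = pm_objective \<Gamma> x)"

subsection \<open>Arc model\<close>

definition am_feasible :: "nat \<Rightarrow> ('b \<Rightarrow> real) \<Rightarrow> bool" where
  "am_feasible \<Gamma> x \<longleftrightarrow>
     (\<forall>a\<in>arcs G. 0 \<le> x a) \<and>
     (\<forall>v\<in>verts G - {s, t}. \<forall>z\<in>scenario_vectors \<Gamma>.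
        (\<Sum>a\<in>in_arcs G v. (1 - z a) * x a) - (\<Sum>a\<in>out_arcs G v. x a) \<ge> 0) \<and>
     (\<forall>a\<in>arcs G. x a \<le> real (u a))"

definition am_objective :: "nat \<Rightarrow> ('b \<Rightarrow> real) \<Rightarrow> real" where
  "am_objective \<Gamma> x =
     (\<Sum>a\<in>in_arcs G t. x a) - (MAX z\<in>scenario_vectors \<Gamma>. \<Sum>a\<in>in_arcs G t. z a * x a)"

definition am_optimal_value :: "nat \<Rightarrow> real \<Rightarrow> bool" where
  "am_optimal_value \<Gamma> f \<longleftrightarrow>
     (\<exists>x. is_arg_max (am_objective \<Gamma>) (am_feasible \<Gamma>) x \<and> f = am_objective \<Gamma> x)"

subsection \<open>General model\<close>

definition gm_feasible :: "nat \<Rightarrow> ('b set \<Rightarrow> real) \<Rightarrow> bool" where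
  "gm_feasible \<Gamma> x \<longleftrightarrow>
     (\<forall>P\<in>subpaths. 0 \<le> x P) \<and>
     (\<forall>v\<in>verts G - {s, t}. \<forall>S\<in>scenarios \<Gamma>.
        (\<Sum>P\<in>subpaths_in v. x P) - (\<Sum>P\<in>{P \<in> subpaths_in v. P \<inter> S \<noteq> {}}. x P)
        \<ge> (\<Sum>P\<in>subpaths_out v. x P)) \<and>
     (\<forall>a\<in>arcs G. (\<Sum>P\<in>{P \<in> subpaths. a \<in> P}. x P) \<le> real (u a))"

definition gm_objective :: "nat \<Rightarrow> ('b set \<Rightarrow> real) \<Rightarrow> real" where
  "gm_objective \<Gamma> x =
     (\<Sum>P\<in>subpaths_in t. x P)
     - (MAX S\<in>scenarios \<Gamma>. \<Sum>P\<in>{P \<in> subpaths_in t. P \<inter> S \<noteq> {}}. x P)"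

definition gm_optimal_value :: "nat \<Rightarrow> real \<Rightarrow> bool" where
  "gm_optimal_value \<Gamma> f \<longleftrightarrow>
     (\<exists>x. is_arg_max (gm_objective \<Gamma>) (gm_feasible \<Gamma>) x \<and> f = gm_objective \<Gamma> x)"

end

end

theory Submission
  imports Defs
begin

text \<open>
  The instance has a single inner node. It is entered by \<open>\<Gamma> + 1\<close> arcs, each able to carry the whole
  flow, and left by \<open>m\<close> arcs of capacity 1. In the arc and the general model the inner node receives
  \<open>m\<close> units under every scenario and redistributes them over the leaving arcs, so only \<open>\<Gamma>\<close>
  units are lost. In the path model every unit is tied to one entering arc, and destroying all but
  the least loaded of these leaves at most \<open>m / (\<Gamma> + 1)\<close>. The ratio is
  \<open>(\<Gamma> + 1) (m - \<Gamma>) / m\<close>, which for \<open>m = \<beta> \<Gamma> (\<Gamma> + 1)\<close> equals \<open>\<Gamma> + 1 - 1 / \<beta>\<close>.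
\<close>

text \<open>This splits each optimal value into a bound valid for all feasible points and one
  feasible point that reaches it; antisymmetry turns the two inequalities into attainment.\<close>

lemma maximum_attainedI:
  fixes f :: "'a \<Rightarrow> 'b::linorder"
  assumes "P x" and "\<And>y. P y \<Longrightarrow> f y \<le> c" and "c \<le> f x"
  shows "\<exists>x. is_arg_max f P x \<and> c = f x"
  using assms by (intro exI[of _ x]) (auto simp: is_arg_max_def not_less intro: order_trans antisym)

section \<open>The two-stage network and its walks\<close>

locale two_stage_network =
  fixes g m :: nat
  assumes g_less_m: "g < m"
begin

definition I :: "nat set" where "I = {..g}"
definition J :: "nat set" where "J = {Suc g..g + m}"

definition net :: "(nat, nat) pre_digraph" where
  "net = \<lparr>verts = {0, 1, 2}, arcs = I \<union> J,
     tail = (\<lambda>a. if a \<in> I then 0 else 1), head = (\<lambda>a. if a \<in> I then 1 else 2)\<rparr>"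

definition cap :: "nat \<Rightarrow> nat" where
  "cap a = (if a \<in> I then m else 1)"

lemma finite_IJ [simp]: "finite I" "finite J"
  and card_IJ [simp]: "card I = Suc g" "card J = m"
  by (auto simp: I_def J_def)

lemma zero_in_I: "0 \<in> I" and Suc_g_in_J: "Suc g \<in> J"
  using g_less_m by (auto simp: I_def J_def)

lemma J_not_I [simp]: "a \<in> J \<Longrightarrow> a \<notin> I"
  by (auto simp: I_def J_def)

lemma net_simps [simp]:
  "verts net = {0, 1, 2}" "arcs net = I \<union> J"
  "tail net a = (if a \<in> I then 0 else 1)" "head net a = (if a \<in> I then 1 else 2)"
  by (auto simp: net_def)

lemma in_out_arcs [simp]:
  "in_arcs net 0 = {}" "in_arcs net (Suc 0) = I" "in_arcs net 2 = J"
  "out_arcs net 2 = {}" "out_arcs net (Suc 0) = J"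
  by (auto simp: in_arcs_def out_arcs_def split: if_splits)

lemma fin_digraph_net: "fin_digraph net"
  by unfold_locales auto

interpretation fin_digraph net by (rule fin_digraph_net)

text \<open>Walks are classified from the sink backwards: peeling off the first arc moves one layer
  ahead, so each case reduces to the one before it and no walk has more than two arcs.\<close>

lemma awalk_from_2: "awalk 2 p w \<longleftrightarrow> p = [] \<and> w = 2"
  by (cases p) (auto simp: awalk_Nil_iff awalk_Cons_iff split: if_splits)

lemma awalk_from_1: "awalk 1 p w \<longleftrightarrow> p = [] \<and> w = 1 \<or> (\<exists>j\<in>J. p = [j] \<and> w = 2)"
  by (cases p) (auto simp: awalk_Nil_iff awalk_Cons_iff awalk_from_2 split: if_splits)

lemma awalk_from_0:
  "awalk 0 p w \<longleftrightarrow> p = [] \<and> w = 0 \<or> (\<exists>i\<in>I. p = [i] \<and> w = 1)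
     \<or> (\<exists>i\<in>I. \<exists>j\<in>J. p = [i, j] \<and> w = 2)"
  by (cases p)
    (auto simp: awalk_Nil_iff awalk_Cons_iff awalk_from_1[unfolded One_nat_def] split: if_splits)

lemma apath_0_2: "apath 0 p 2 \<longleftrightarrow> (\<exists>i\<in>I. \<exists>j\<in>J. p = [i, j])"
  by (auto simp: apath_def awalk_from_0)

lemma flow_network_net: "flow_network net 0 2 cap"
proof
  fix v assume "v \<in> verts net - {0, 2}"
  with zero_in_I Suc_g_in_J show "\<exists>p. apath 0 p 2 \<and> v \<in> set (awalk_verts 0 p)"
    by (intro exI[of _ "[0, Suc g]"]) (auto simp: apath_0_2)
qed (use g_less_m in \<open>auto simp: cap_def\<close>)

sublocale flow_network net 0 2 cap
  by (rule flow_network_net)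

text \<open>The walk classification leaves only these arc lists. Conversely, a single arc extends to
  a source-sink path by any arc of the other layer; \<open>Suc g\<close> and \<open>0\<close> serve
  as these partners.\<close>

lemma is_subpath_iff:
  "is_subpath v q w \<longleftrightarrow> (\<exists>i\<in>I. v = 0 \<and> q = [i] \<and> w = 1) \<or> (\<exists>j\<in>J. v = 1 \<and> q = [j] \<and> w = 2)
     \<or> (\<exists>i\<in>I. \<exists>j\<in>J. v = 0 \<and> q = [i, j] \<and> w = 2)"
  (is "_ \<longleftrightarrow> ?R")
proof
  assume *: "is_subpath v q w"
  then have "v \<in> {0, 1, 2}" and "awalk v q w" and "q \<noteq> []"
    by (auto simp: is_subpath_def apath_def awalk_def)
  then show ?R
    using awalk_from_0[of q w] awalk_from_1[of q w] awalk_from_2[of q w] by auto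
next
  have sub: "is_subpath v q w"
    if "i \<in> I" "j \<in> J" "sublist q [i, j]" "apath v q w" "q \<noteq> []" for i j
    using that by (auto simp: is_subpath_def apath_0_2)
  assume ?R
  then consider (1) i where "i \<in> I" "v = 0" "q = [i]" "w = 1"
    | (2) j where "j \<in> J" "v = 1" "q = [j]" "w = 2"
    | (3) i j where "i \<in> I" "j \<in> J" "v = 0" "q = [i, j]" "w = 2"
    by blast
  then show "is_subpath v q w"
  proof cases
    case 1
    then have "apath v q w" by (auto simp: apath_def awalk_from_0)
    with 1 Suc_g_in_J show ?thesis by (intro sub[of i "Suc g"]) auto
  next
    case 2
    then have "apath v q w"
      by (auto simp: apath_def awalk_from_1[unfolded One_nat_def])
    with 2 zero_in_I show ?thesis by (intro sub[of 0 j]) (auto simp: sublist_Cons_right)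
  next
    case 3
    then have "apath v q w" by (simp add: apath_0_2)
    with 3 show ?thesis by (intro sub[of i j]) auto
  qed
qed

section \<open>Path sets and sums over them\<close>

lemma st_paths_eq: "st_paths = (\<lambda>(i, j). {i, j}) ` (I \<times> J)"
  unfolding st_paths_def apath_0_2 by (force simp: image_def)

lemma subpaths_in_1: "subpaths_in (Suc 0) = (\<lambda>i. {i}) ` I"
  and subpaths_out_1: "subpaths_out (Suc 0) = (\<lambda>j. {j}) ` J"
  and subpaths_in_2: "subpaths_in 2 = st_paths \<union> (\<lambda>j. {j}) ` J"
  and subpaths_eq: "subpaths = st_paths \<union> (\<lambda>a. {a}) ` (I \<union> J)"
proof -
  have "subpaths_in w = set ` {q. \<exists>v. is_subpath v q w}"
    and "subpaths_out w = set ` {q. \<exists>v. is_subpath w q v}"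
    and "subpaths = set ` {q. \<exists>v w. is_subpath v q w}" for w
    by (auto simp: subpaths_in_def subpaths_out_def subpaths_def)
  \<comment> \<open>The case analysis is done on arc lists, and only its result is mapped to arc
    sets by \<open>set\<close>.\<close>
  moreover have "{q. \<exists>v. is_subpath v q (Suc 0)} = (\<lambda>i. [i]) ` I"
    and "{q. \<exists>w. is_subpath (Suc 0) q w} = (\<lambda>j. [j]) ` J"
    and "{q. \<exists>v. is_subpath v q 2} = (\<lambda>(i, j). [i, j]) ` (I \<times> J) \<union> (\<lambda>j. [j]) ` J"
    and "{q. \<exists>v w. is_subpath v q w} = (\<lambda>(i, j). [i, j]) ` (I \<times> J) \<union> (\<lambda>a. [a]) ` (I \<union> J)"
    by (auto simp: is_subpath_iff ex_disj_distrib)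
  ultimately show "subpaths_in (Suc 0) = (\<lambda>i. {i}) ` I"
    and "subpaths_out (Suc 0) = (\<lambda>j. {j}) ` J"
    and "subpaths_in 2 = st_paths \<union> (\<lambda>j. {j}) ` J"
    and "subpaths = st_paths \<union> (\<lambda>a. {a}) ` (I \<union> J)"
    by (simp_all add: st_paths_eq image_Un image_image case_prod_unfold)
qed

text \<open>As \<open>I\<close> and \<open>J\<close> are disjoint, the set \<open>{i, j}\<close>
  reveals which of its elements is the entering arc. This lets sums over arc sets become double sums
  over indices.\<close>

lemma inj_doubleton: "inj_on (\<lambda>(i, j). {i, j}) (I \<times> J)"
  by (rule inj_onI) (auto simp: doubleton_eq_iff)

lemma finite_paths [simp]: "finite st_paths" "finite (subpaths_in 2)" "finite subpaths"
  by (auto simp: st_paths_eq subpaths_in_2 subpaths_eq)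

lemma sum_st_paths: "(\<Sum>P\<in>st_paths. x P) = (\<Sum>i\<in>I. \<Sum>j\<in>J. x {i, j})"
proof -
  have "(\<Sum>P\<in>st_paths. x P) = sum (x \<circ> (\<lambda>(i, j). {i, j})) (I \<times> J)"
    unfolding st_paths_eq by (rule sum.reindex[OF inj_doubleton])
  also have "\<dots> = (\<Sum>(i, j)\<in>I \<times> J. x {i, j})"
    by (simp add: case_prod_unfold comp_def)
  finally show ?thesis by (simp add: sum.cartesian_product)
qed

lemma st_paths_through_I: "i \<in> I \<Longrightarrow> {P \<in> st_paths. i \<in> P} = (\<lambda>j. {i, j}) ` J"
  by (auto simp: st_paths_eq)

lemma st_paths_through_J: "j \<in> J \<Longrightarrow> {P \<in> st_paths. j \<in> P} = (\<lambda>i. {i, j}) ` I"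
  by (auto simp: st_paths_eq)

lemma sum_st_paths_through:
  "i \<in> I \<Longrightarrow> (\<Sum>P\<in>{P \<in> st_paths. i \<in> P}. x P) = (\<Sum>j\<in>J. x {i, j})"
  "j \<in> J \<Longrightarrow> (\<Sum>P\<in>{P \<in> st_paths. j \<in> P}. x P) = (\<Sum>i\<in>I. x {i, j})"
proof -
  have "inj_on (\<lambda>j. {i, j}) J" "inj_on (\<lambda>i. {i, j}) I"
    by (auto simp: inj_on_def doubleton_eq_iff)
  then show "i \<in> I \<Longrightarrow> (\<Sum>P\<in>{P \<in> st_paths. i \<in> P}. x P) = (\<Sum>j\<in>J. x {i, j})"
    and "j \<in> J \<Longrightarrow> (\<Sum>P\<in>{P \<in> st_paths. j \<in> P}. x P) = (\<Sum>i\<in>I. x {i, j})"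
    by (simp_all add: st_paths_through_I st_paths_through_J sum.reindex)
qed

section \<open>Scenarios and worst-case losses\<close>

lemma scenarios_finite: "finite (scenarios \<Gamma>)"
  by (rule finite_subset[of _ "Pow (I \<union> J)"]) (auto simp: scenarios_def)

lemma empty_scenario: "{} \<in> scenarios \<Gamma>"
  by (simp add: scenarios_def)

lemma scenario_vectors_finite: "finite (scenario_vectors \<Gamma>)"
  by (rule finite_subset[of _ "(I \<union> J) \<rightarrow>\<^sub>E {0, 1}"])
    (auto simp: scenario_vectors_def intro: finite_PiE)

lemma sum_minus_hit:
  fixes x :: "'c set \<Rightarrow> real"
  assumes "finite A"
  shows "(\<Sum>P\<in>A. x P) - (\<Sum>P\<in>{P \<in> A. P \<inter> S \<noteq> {}}. x P) = (\<Sum>P\<in>{P \<in> A. P \<inter> S = {}}. x P)"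
proof -
  have "A - {P \<in> A. P \<inter> S \<noteq> {}} = {P \<in> A. P \<inter> S = {}}" by auto
  then show ?thesis using sum_diff[of A "{P \<in> A. P \<inter> S \<noteq> {}}" x] assms by simp
qed

text \<open>The worst case loses at least as much as \<open>S\<close> does, so at most the paths
  surviving \<open>S\<close> count. The set \<open>A\<close> is left open to cover both
  \<open>st_paths\<close> and \<open>subpaths_in 2\<close>.\<close>

lemma scenario_objective_le:
  fixes x :: "nat set \<Rightarrow> real"
  assumes "finite A" and "S \<in> scenarios \<Gamma>"
  shows "(\<Sum>P\<in>A. x P) - (MAX S\<in>scenarios \<Gamma>. \<Sum>P\<in>{P \<in> A. P \<inter> S \<noteq> {}}. x P)
     \<le> (\<Sum>P\<in>{P \<in> A. P \<inter> S = {}}. x P)"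
proof -
  have "(\<Sum>P\<in>{P \<in> A. P \<inter> S \<noteq> {}}. x P)
      \<le> (MAX S\<in>scenarios \<Gamma>. \<Sum>P\<in>{P \<in> A. P \<inter> S \<noteq> {}}. x P)"
    using assms scenarios_finite by (intro Max_ge) auto
  then show ?thesis using sum_minus_hit[OF assms(1), of x S] by linarith
qed

lemma scenario_Max_le:
  fixes f :: "nat set \<Rightarrow> real"
  assumes "\<And>S. S \<in> scenarios \<Gamma> \<Longrightarrow> f S \<le> c"
  shows "(MAX S\<in>scenarios \<Gamma>. f S) \<le> c"
  using assms scenarios_finite empty_scenario by (subst Max_le_iff) auto

section \<open>The path model\<close>

lemma pm_objective_le:
  assumes "pm_feasible x"
  shows "pm_objective g x \<le> m / (g + 1)"
proof -
  \<comment> \<open>Of the \<open>g + 1\<close> arcs in \<open>I\<close>, all but \<open>i\<close>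
    fit exactly into the budget \<open>g\<close>; the survivors are the paths through
    \<open>i\<close>.\<close>
  have "pm_objective g x \<le> (\<Sum>j\<in>J. x {i, j})" if i: "i \<in> I" for i
  proof -
    have "I - {i} \<in> scenarios g"
      using i by (auto simp: scenarios_def)
    moreover have "{P \<in> st_paths. P \<inter> (I - {i}) = {}} = {P \<in> st_paths. i \<in> P}"
      using i by (auto simp: st_paths_eq)
    ultimately show ?thesis
      using scenario_objective_le[of st_paths "I - {i}" g x] i
      by (simp add: pm_objective_def sum_st_paths_through)
  qed
  \<comment> \<open>Adding up the bounds for all \<open>i\<close> avoids picking a least loaded arc:
    \<open>g + 1\<close> times the objective is at most the total flow, which the unit capacities of
    \<open>J\<close> limit to \<open>m\<close>.\<close>
  then have "(\<Sum>i\<in>I. pm_objective g x) \<le> (\<Sum>i\<in>I. \<Sum>j\<in>J. x {i, j})"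
    by (rule sum_mono)
  also have "\<dots> = (\<Sum>j\<in>J. \<Sum>i\<in>I. x {i, j})" by (rule sum.swap)
  also have "\<dots> \<le> (\<Sum>j\<in>J. 1)"
  proof (rule sum_mono)
    fix j assume j: "j \<in> J"
    then have "(\<Sum>P\<in>{P \<in> st_paths. j \<in> P}. x P) \<le> cap j"
      using assms by (simp add: pm_feasible_def)
    then show "(\<Sum>i\<in>I. x {i, j}) \<le> 1"
      using j by (simp add: sum_st_paths_through(2) cap_def)
  qed
  finally show ?thesis by (simp add: field_simps)
qed

lemma pm_optimal: "pm_optimal_value g (m / (g + 1))"
proof -
  \<comment> \<open>The uniform flow saturates every arc of \<open>J\<close>, which lies on
    \<open>g + 1\<close> paths, and loads all arcs of \<open>I\<close> equally with
    \<open>m / (g + 1)\<close>.\<close>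
  define x :: "nat set \<Rightarrow> real" where "x = (\<lambda>_. 1 / (g + 1))"
  have m1: "1 \<le> m" using g_less_m by simp
  have load: "(\<Sum>P\<in>{P \<in> st_paths. a \<in> P}. x P) \<le> cap a" if "a \<in> I \<union> J" for a
    using that m1 by (auto simp: sum_st_paths_through cap_def) (auto simp: x_def field_simps)
  \<comment> \<open>An arc of \<open>I\<close> lies on \<open>m\<close> paths and an arc of
    \<open>J\<close> on \<open>g + 1\<close>, which is at most \<open>m\<close> by
    \<open>g_less_m\<close>. Hence a union bound over at most \<open>g\<close> destroyed arcs gives
    the loss.\<close>
  have card_through: "card {P \<in> st_paths. a \<in> P} \<le> m" if "a \<in> I \<union> J" for a
    using that g_less_m card_image_le[OF finite_IJ(1), of "\<lambda>i. {i, a}"]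
      card_image_le[OF finite_IJ(2), of "\<lambda>j. {a, j}"]
    by (auto simp: st_paths_through_I st_paths_through_J)
  have feasible: "pm_feasible x"
    using load by (auto simp: pm_feasible_def x_def)
  have loss: "(\<Sum>P\<in>{P \<in> st_paths. P \<inter> S \<noteq> {}}. x P) \<le> g * (m / (g + 1))"
    if S: "S \<in> scenarios g" for S
  proof -
    have finS: "finite S" and SIJ: "S \<subseteq> I \<union> J"
      using S finite_subset[of S "I \<union> J"] by (auto simp: scenarios_def)
    have "card {P \<in> st_paths. P \<inter> S \<noteq> {}} = card (\<Union>a\<in>S. {P \<in> st_paths. a \<in> P})"
      by (rule arg_cong[of _ _ card]) auto
    also have "\<dots> \<le> (\<Sum>a\<in>S. card {P \<in> st_paths. a \<in> P})"
      using finS by (rule card_UN_le)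
    also have "\<dots> \<le> card S * m"
      using sum_bounded_above[of S "\<lambda>a. card {P \<in> st_paths. a \<in> P}" m] card_through SIJ by auto
    also have "\<dots> \<le> g * m"
      using S by (simp add: scenarios_def)
    finally have "real (card {P \<in> st_paths. P \<inter> S \<noteq> {}}) \<le> real (g * m)"
      by (rule of_nat_mono)
    then show ?thesis by (simp add: x_def divide_right_mono)
  qed
  have "m / (g + 1) = m - g * (m / (g + 1))" by (simp add: field_simps)
  also have "\<dots> \<le> pm_objective g x"
  proof -
    have "(\<Sum>P\<in>st_paths. x P) = m" unfolding sum_st_paths by (simp add: x_def field_simps)
    then show ?thesis
      using scenario_Max_le[OF loss] by (simp add: pm_objective_def)
  qed
  finally show ?thesis
    unfolding pm_optimal_value_def
    by (intro maximum_attainedI[where P = "pm_feasible" and x = x] feasible pm_objective_le)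
qed

text \<open>A fixed scenario of \<open>g\<close> arcs into the sink, giving the upper bound in both
  the arc and the general model.\<close>

definition K :: "nat set" where "K = {Suc g..g + g}"

lemma K_subset: "K \<subseteq> J" and card_K [simp]: "card K = g" and finite_K [simp]: "finite K"
  using g_less_m by (auto simp: K_def J_def)

lemma card_J_K: "card (J - K) = m - g"
  using K_subset by (simp add: card_Diff_subset)

section \<open>The arc model\<close>

lemma am_objective_le:
  assumes "am_feasible g x"
  shows "am_objective g x \<le> real m - g"
proof -
  \<comment> \<open>The indicator of \<open>K\<close>, restricted to the arc set because members of
    \<open>scenario_vectors\<close> are extensional.\<close>
  define z :: "nat \<Rightarrow> real" where "z = (\<lambda>a\<in>I \<union> J. if a \<in> K then 1 else 0)"
  have "(\<Sum>a\<in>I \<union> J. z a) = (\<Sum>a\<in>K. 1)"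
    using K_subset by (intro sum.mono_neutral_cong_right) (auto simp: z_def)
  then have "z \<in> scenario_vectors g"
    by (auto simp: scenario_vectors_def z_def)
  then have "(\<Sum>a\<in>J. z a * x a) \<le> (MAX z\<in>scenario_vectors g. \<Sum>a\<in>J. z a * x a)"
    using scenario_vectors_finite by (intro Max_ge) auto
  then have "am_objective g x \<le> (\<Sum>a\<in>J. x a) - (\<Sum>a\<in>J. z a * x a)"
    by (simp add: am_objective_def)
  also have "(\<Sum>a\<in>J. z a * x a) = (\<Sum>a\<in>K. x a)"
    using K_subset by (intro sum.mono_neutral_cong_right) (auto simp: z_def)
  also have "(\<Sum>a\<in>J. x a) - (\<Sum>a\<in>K. x a) = (\<Sum>a\<in>J - K. x a)"
    using K_subset by (simp add: sum_diff)
  \<comment> \<open>The \<open>m - g\<close> surviving arcs have capacity 1 each.\<close>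
  also have "\<dots> \<le> (\<Sum>a\<in>J - K. 1)"
  proof (rule sum_mono)
    fix a assume a: "a \<in> J - K"
    then have "x a \<le> cap a"
      using assms by (simp add: am_feasible_def)
    then show "x a \<le> 1"
      using a by (simp add: cap_def)
  qed
  finally show ?thesis using g_less_m by (simp add: card_J_K)
qed

lemma am_optimal: "am_optimal_value g (real m - g)"
proof -
  \<comment> \<open>Every arc is saturated: node 1 is sent \<open>(g + 1) * m\<close> units, a
    scenario removes at most \<open>g * m\<close> of them, and the remaining \<open>m\<close> fill
    \<open>J\<close>.\<close>
  define x :: "nat \<Rightarrow> real" where "x = (\<lambda>a. real (cap a))"
  have z_bound: "(\<Sum>a\<in>A. z a) \<le> g" if "z \<in> scenario_vectors g" "A \<subseteq> I \<union> J" for z A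
  proof -
    have "(\<Sum>a\<in>A. z a) \<le> (\<Sum>a\<in>I \<union> J. z a)"
      using that by (intro sum_mono2) (force simp: scenario_vectors_def PiE_def Pi_def)+
    then show ?thesis using that by (simp add: scenario_vectors_def)
  qed
  have xJ: "(\<Sum>a\<in>J. x a) = m" and zxJ: "(\<Sum>a\<in>J. z a * x a) = (\<Sum>a\<in>J. z a)" for z
    by (simp_all add: x_def cap_def)
  have "m \<le> (\<Sum>a\<in>I. (1 - z a) * x a)" if "z \<in> scenario_vectors g" for z
  proof -
    have "(\<Sum>a\<in>I. (1 - z a) * x a) = (g + 1 - (\<Sum>a\<in>I. z a)) * m"
      by (simp add: x_def cap_def sum_distrib_right[symmetric] sum_subtractf)
    moreover have "1 * real m \<le> (g + 1 - (\<Sum>a\<in>I. z a)) * m"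
      using z_bound[OF that, of I] by (intro mult_right_mono) auto
    ultimately show ?thesis by simp
  qed
  then have feasible: "am_feasible g x"
    by (auto simp: am_feasible_def xJ) (auto simp: x_def)
  \<comment> \<open>The zero vector shows that the maximum below is over a nonempty set.\<close>
  have "restrict (\<lambda>_. 0) (I \<union> J) \<in> scenario_vectors g"
    by (auto simp: scenario_vectors_def)
  then have "(MAX z\<in>scenario_vectors g. \<Sum>a\<in>J. z a * x a) \<le> g"
    using scenario_vectors_finite z_bound by (subst Max_le_iff) (auto simp: zxJ)
  then have "real m - g \<le> am_objective g x"
    by (simp add: am_objective_def xJ)
  then show ?thesis
    unfolding am_optimal_value_def
    by (intro maximum_attainedI[where P = "am_feasible g" and x = x] feasible am_objective_le)
qed

section \<open>The general model\<close>

lemma gm_objective_le: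
  assumes "gm_feasible g x"
  shows "gm_objective g x \<le> real m - g"
proof -
  have "K \<in> scenarios g"
    using K_subset by (auto simp: scenarios_def)
  then have "gm_objective g x \<le> (\<Sum>P\<in>{P \<in> subpaths_in 2. P \<inter> K = {}}. x P)"
    unfolding gm_objective_def by (intro scenario_objective_le) auto
  \<comment> \<open>A path into the sink that avoids \<open>K\<close> uses an arc of
    \<open>J - K\<close>. No path has two arcs of \<open>J\<close>, so grouping by this arc is a
    disjoint union and the arc capacities apply.\<close>
  also have "\<dots> \<le> (\<Sum>P\<in>(\<Union>j\<in>J - K. {P \<in> subpaths. j \<in> P}). x P)"
    using assms
    by (intro sum_mono2) (auto simp: gm_feasible_def subpaths_in_2 subpaths_eq st_paths_eq)
  also have "\<dots> = (\<Sum>j\<in>J - K. \<Sum>P\<in>{P \<in> subpaths. j \<in> P}. x P)"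
    by (intro sum.UNION_disjoint) (auto simp: subpaths_eq st_paths_eq)
  also have "\<dots> \<le> (\<Sum>j\<in>J - K. 1)"
  proof (rule sum_mono)
    fix j assume j: "j \<in> J - K"
    then have "(\<Sum>P\<in>{P \<in> subpaths. j \<in> P}. x P) \<le> cap j"
      using assms by (simp add: gm_feasible_def)
    then show "(\<Sum>P\<in>{P \<in> subpaths. j \<in> P}. x P) \<le> 1"
      using j by (simp add: cap_def)
  qed
  finally show ?thesis using g_less_m by (simp add: card_J_K)
qed

lemma gm_optimal: "gm_optimal_value g (real m - g)"
proof -
  \<comment> \<open>The saturating arc flow carried over: single-arc paths get the capacity of their
    arc, two-arc paths get 0.\<close>
  define x :: "nat set \<Rightarrow> real" where
    "x = (\<lambda>P. if card P = 1 then cap (the_elem P) else 0)"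
  have x_single [simp]: "x {a} = cap a" for a
    by (simp add: x_def)
  have x_nonneg: "0 \<le> x P" for P
    by (simp add: x_def)
  have x_st: "x P = 0" if "P \<in> st_paths" for P
    using that by (auto simp: x_def st_paths_eq card_insert_if split: if_splits)
  \<comment> \<open>Members of \<open>A\<close> carry no flow, so sums over paths collapse to sums
    of capacities; \<open>A = {}\<close> handles the families of single arcs.\<close>
  have sum_x: "(\<Sum>P\<in>A \<union> (\<lambda>a. {a}) ` B. x P) = (\<Sum>a\<in>B. cap a)"
    if "A \<subseteq> st_paths" "finite B" for A B
  proof -
    have "finite A" using that finite_subset finite_paths(1) by blast
    then have "(\<Sum>P\<in>A \<union> (\<lambda>a. {a}) ` B. x P) = (\<Sum>P\<in>(\<lambda>a. {a}) ` B. x P)"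
      using that x_st by (intro sum.mono_neutral_right) auto
    then show ?thesis by (simp add: sum.reindex)
  qed
  have cardS: "card (A \<inter> S) \<le> g" if "S \<in> scenarios g" for A S
    using that finite_subset[of S "I \<union> J"] card_mono[of S "A \<inter> S"]
    by (auto simp: scenarios_def)
  have out: "(\<Sum>P\<in>subpaths_out (Suc 0). x P) = m"
    using sum_x[of "{}" J] by (simp add: subpaths_out_1 cap_def)
  \<comment> \<open>Conservation at node 1: at most \<open>g\<close> of the \<open>g + 1\<close>
    entering units of size \<open>m\<close> are lost.\<close>
  have "m + (\<Sum>P\<in>{P \<in> subpaths_in (Suc 0). P \<inter> S \<noteq> {}}. x P) \<le> (\<Sum>P\<in>subpaths_in (Suc 0). x P)"
    if S: "S \<in> scenarios g" for S
  proof -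
    have eq: "{P \<in> subpaths_in (Suc 0). P \<inter> S \<noteq> {}} = {} \<union> (\<lambda>a. {a}) ` (I \<inter> S)"
      by (auto simp: subpaths_in_1)
    have "(\<Sum>P\<in>{P \<in> subpaths_in (Suc 0). P \<inter> S \<noteq> {}}. x P) = (\<Sum>a\<in>I \<inter> S. cap a)"
      unfolding eq by (rule sum_x) auto
    also have "\<dots> = card (I \<inter> S) * real m" by (simp add: cap_def)
    also have "\<dots> \<le> g * real m"
      using cardS[OF S, of I] by (intro mult_right_mono) auto
    finally show ?thesis
      using sum_x[of "{}" I] by (simp add: subpaths_in_1 cap_def algebra_simps)
  qed
  moreover have "(\<Sum>P\<in>{P \<in> subpaths. a \<in> P}. x P) = cap a" if "a \<in> I \<union> J" for a
  proof -
    \<comment> \<open>Among the paths through \<open>a\<close>, only \<open>{a}\<close> itself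
      carries flow.\<close>
    have eq: "{P \<in> subpaths. a \<in> P} = {P \<in> st_paths. a \<in> P} \<union> (\<lambda>a. {a}) ` {a}"
      using that by (auto simp: subpaths_eq)
    show ?thesis unfolding eq by (subst sum_x) auto
  qed
  ultimately have feasible: "gm_feasible g x"
    by (auto simp: gm_feasible_def out x_nonneg algebra_simps)
  have "(\<Sum>P\<in>{P \<in> subpaths_in 2. P \<inter> S \<noteq> {}}. x P) \<le> g" if S: "S \<in> scenarios g" for S
  proof -
    have eq: "{P \<in> subpaths_in 2. P \<inter> S \<noteq> {}}
        = {P \<in> st_paths. P \<inter> S \<noteq> {}} \<union> (\<lambda>a. {a}) ` (J \<inter> S)"
      by (auto simp: subpaths_in_2)
    have "(\<Sum>P\<in>{P \<in> subpaths_in 2. P \<inter> S \<noteq> {}}. x P) = (\<Sum>a\<in>J \<inter> S. cap a)"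
      unfolding eq by (rule sum_x) auto
    also have "\<dots> = card (J \<inter> S)" by (simp add: cap_def)
    finally show ?thesis using cardS[OF S, of J] by simp
  qed
  then have "(MAX S\<in>scenarios g. \<Sum>P\<in>{P \<in> subpaths_in 2. P \<inter> S \<noteq> {}}. x P) \<le> g"
    by (rule scenario_Max_le)
  moreover have "(\<Sum>P\<in>subpaths_in 2. x P) = m"
    unfolding subpaths_in_2 by (subst sum_x) (auto simp: cap_def)
  ultimately have "real m - g \<le> gm_objective g x"
    by (simp add: gm_objective_def)
  then show ?thesis
    unfolding gm_optimal_value_def
    by (intro maximum_attainedI[where P = "gm_feasible g" and x = x] feasible gm_objective_le)
qed

end

theorem proposition3p9:
  fixes \<Gamma> \<beta> :: nat and \<alpha> :: real
  assumes "\<Gamma> \<ge> 1" and "\<beta> \<ge> 1" and "\<alpha> = real \<Gamma> + 1 - 1 / real \<beta>"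
  shows "\<exists>(G :: (nat, nat) pre_digraph) s t u f_pm f_am f_gm.
           flow_network G s t u \<and>
           flow_network.pm_optimal_value G s t u \<Gamma> f_pm \<and>
           flow_network.am_optimal_value G s t u \<Gamma> f_am \<and>
           flow_network.gm_optimal_value G s t u \<Gamma> f_gm \<and>
           f_pm > 0 \<and>
           f_am = \<alpha> * f_pm \<and>
           f_gm = \<alpha> * f_pm"
proof -
  \<comment> \<open>The ratio is \<open>\<Gamma> + 1 - \<Gamma> * (\<Gamma> + 1) / m\<close>;
    equating the subtracted fraction with \<open>1 / \<beta>\<close> yields this \<open>m\<close>,
    and the path model then has value \<open>\<beta> * \<Gamma>\<close>.\<close>
  define m where "m = \<beta> * \<Gamma> * (\<Gamma> + 1)"
  \<comment> \<open>This is the locale assumption \<open>g_less_m\<close>; it holds since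
    \<open>\<beta> * (\<Gamma> + 1)\<close> is at least 2.\<close>
  have "\<Gamma> * 1 < \<Gamma> * (\<beta> * (\<Gamma> + 1))"
    using assms(1) mult_le_mono1[OF assms(2), of "\<Gamma> + 1"]
    by (intro mult_strict_left_mono) auto
  then interpret two_stage_network \<Gamma> m
    using assms by unfold_locales (auto simp: m_def algebra_simps)
  have "m / (\<Gamma> + 1) = \<beta> * \<Gamma>"
    by (simp add: m_def field_simps)
  then have pm: "pm_optimal_value \<Gamma> (\<beta> * \<Gamma>)" and "0 < real (\<beta> * \<Gamma>)"
    using pm_optimal assms by simp_all
  moreover have "real m - \<Gamma> = \<alpha> * (\<beta> * \<Gamma>)"
  proof -
    have "real m - \<Gamma> = (real \<beta> * (real \<Gamma> + 1) - 1) * \<Gamma>"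
      by (simp add: m_def algebra_simps)
    also have "real \<beta> * (real \<Gamma> + 1) - 1 = \<alpha> * \<beta>"
      using assms by (simp add: field_simps)
    finally show ?thesis by simp
  qed
  ultimately show ?thesis
    using flow_network_net am_optimal gm_optimal by blast
qed

end
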